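(* For every sequent $S$: if $S$ has a proof in $(\mathsf{Grz}+\mathsf{cut})^\infty$, then $S$ has a proof in $\mathsf{Grz}^\infty$.
   Context: Formulas are built from propositional variables $p,q,\dots$, $\bot$, $\to$ and $\Box$. A sequent is a pair $(\Gamma,\Delta)$ of finite multisets of formulas; $S_0\cup S_1$ is componentwise multiset union; $S,\phi^\bullet$ means $S\cup(\{\phi\},\varnothing)$, $S,\phi^\circ$ means $S\cup(\varnothing,\{\phi\})$, and $S,\Gamma^\bullet$, $S,\Gamma^\circ$ analogously for multisets $\Gamma$; $\Box\Pi$ is $\{\Box\psi:\psi\in\Pi\}$. The rules of $\mathsf{Grz}^\infty$ (premises listed in order, as premise $0,1,\dots$): (Ax) no premises, conclusion $S,p^\bullet,p^\circ$; ($\bot^\bullet$) no premises, conclusion $S,\bot^\bullet$; ($\to^\bullet$) premises $S,\phi^\circ$ and $S,\psi^\bullet$, conclusion $S,(\phi\to\psi)^\bullet$; ($\to^\circ$) premise $S,\phi^\bullet,\psi^\circ$, conclusion $S,(\phi\to\psi)^\circ$; (Refl) premise $S,\phi^\bullet,\Box\phi^\bullet$, conclusion $S,\Box\phi^\bullet$; ($\Box$) premises $S,\Box\Pi^\bullet,\phi^\circ$ and $\Box\Pi^\bullet,\phi^\circ$, conclusion $S,\Box\Pi^\bullet,\Box\phi^\circ$. $(\mathsf{Grz}+\mathsf{cut})^\infty$ additionally has (cut) premises $S,\phi^\circ$ and $S,\phi^\bullet$, conclusion $S$. In both systems a proof of $S$ is a finitely branching, possibly infinite tree whose nodes are labelled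 by a sequent and a rule of the system, with root labelled $S$, such that each node with its children (in order) forms an instance of its rule, and such that every infinite branch passes infinitely often through a node that is the right premise (premise 1) of an instance of $(\Box)$ — this is the only progressing premise. *)

theory Defs
  imports "HOL-Library.Multiset" "HOL-Library.Infinite_Set"
begin

datatype 'v form =
    Var 'v
  | Bot (\<open>\<^bold>\<bottom>\<close>)
  | Imp "'v form" "'v form" (infixr \<open>\<^bold>\<rightarrow>\<close> 60)
  | Box "'v form" (\<open>\<^bold>\<box> _\<close> [70] 70)

text \<open>In a sequent \<open>(\<Gamma>, \<Delta>)\<close>, the formulas of \<open>\<Gamma>\<close> are those marked \<open>\<bullet>\<close>
  and the formulas of \<open>\<Delta>\<close> are those marked \<open>\<circ>\<close>.\<close>

type_synonym 'v sequent = "'v form multiset \<times> 'v form multiset"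

datatype rule = Ax | BotL | ImpL | ImpR | Refl | BoxR | Cut

text \<open>\<open>rule_inst r Ps C\<close>: the premises \<open>Ps\<close> (in order) and the conclusion \<open>C\<close>
  form an instance of rule \<open>r\<close>. The context \<open>S\<close> is \<open>(\<Gamma>, \<Delta>)\<close> throughout; it is
  discarded in the right premise of \<open>BoxR\<close>.\<close>

inductive rule_inst :: "rule \<Rightarrow> 'v sequent list \<Rightarrow> 'v sequent \<Rightarrow> bool" where
  Ax: "rule_inst Ax [] (add_mset (Var p) \<Gamma>, add_mset (Var p) \<Delta>)"
| BotL: "rule_inst BotL [] (add_mset \<^bold>\<bottom> \<Gamma>, \<Delta>)"
| ImpL: "rule_inst ImpL
    [(\<Gamma>, add_mset \<phi> \<Delta>), (add_mset \<psi> \<Gamma>, \<Delta>)]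
    (add_mset (\<phi> \<^bold>\<rightarrow> \<psi>) \<Gamma>, \<Delta>)"
| ImpR: "rule_inst ImpR
    [(add_mset \<phi> \<Gamma>, add_mset \<psi> \<Delta>)]
    (\<Gamma>, add_mset (\<phi> \<^bold>\<rightarrow> \<psi>) \<Delta>)"
| Refl: "rule_inst Refl
    [(add_mset \<phi> (add_mset (\<^bold>\<box> \<phi>) \<Gamma>), \<Delta>)]
    (add_mset (\<^bold>\<box> \<phi>) \<Gamma>, \<Delta>)"
| BoxR: "rule_inst BoxR
    [(\<Gamma> + image_mset Box \<Pi>, add_mset \<phi> \<Delta>), (image_mset Box \<Pi>, {#\<phi>#})]
    (\<Gamma> + image_mset Box \<Pi>, add_mset (\<^bold>\<box> \<phi>) \<Delta>)"
| Cut: "rule_inst Cut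
    [(\<Gamma>, add_mset \<phi> \<Delta>), (add_mset \<phi> \<Gamma>, \<Delta>)]
    (\<Gamma>, \<Delta>)"

definition Grz :: "rule set" where
  "Grz = {Ax, BotL, ImpL, ImpR, Refl, BoxR}"

definition Grz_cut :: "rule set" where
  "Grz_cut = insert Cut Grz"

codatatype 'v ptree =
  Node (concl: "'v sequent") (rule_of: rule) (children: "'v ptree list")

coinductive locally_correct :: "rule set \<Rightarrow> 'v ptree \<Rightarrow> bool" for R where
  "\<lbrakk>r \<in> R; rule_inst r (map concl ts) S; \<forall>t \<in> set ts. locally_correct R t\<rbrakk>
    \<Longrightarrow> locally_correct R (Node S r ts)"

text \<open>An infinite branch of \<open>t\<close> is given by the sequence \<open>d\<close> of directions taken;
  \<open>\<tau> n\<close> is the subtree at the \<open>n\<close>-th node of the branch.\<close>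

definition infinite_branch :: "'v ptree \<Rightarrow> (nat \<Rightarrow> 'v ptree) \<Rightarrow> (nat \<Rightarrow> nat) \<Rightarrow> bool" where
  "infinite_branch t \<tau> d \<longleftrightarrow>
     \<tau> 0 = t \<and>
     (\<forall>n. d n < length (children (\<tau> n)) \<and> \<tau> (Suc n) = children (\<tau> n) ! d n)"

definition progressing :: "'v ptree \<Rightarrow> bool" where
  "progressing t \<longleftrightarrow>
     (\<forall>\<tau> d. infinite_branch t \<tau> d \<longrightarrow> (\<exists>\<^sub>\<infinity>n. rule_of (\<tau> n) = BoxR \<and> d n = 1))"

definition is_proof :: "rule set \<Rightarrow> 'v ptree \<Rightarrow> 'v sequent \<Rightarrow> bool" where
  "is_proof R t S \<longleftrightarrow> concl t = S \<and> locally_correct R t \<and> progressing t"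

definition has_proof :: "rule set \<Rightarrow> 'v sequent \<Rightarrow> bool" where
  "has_proof R S \<longleftrightarrow> (\<exists>t. is_proof R t S)"

end

theory Submission
  imports Defs
begin

text \<open>The argument is semantic. Finite trees, ordered by the subtree relation, are Kripke frames
  for \<open>Grz\<close>. Proofs with cut are sound for them: a refuted conclusion has a refuted premise, and
  the refuting world can be kept fixed except at progressing premises, where it moves to a
  proper subtree; along an infinite branch this would happen infinitely often. Conversely, every
  valid sequent has a cut-free proof, found by bottom-up proof search. The search records in
  \<open>\<Theta>\<close> the boxed antecedents that have already been unfolded by \<open>Refl\<close>; these need only hold in
  the proper subtrees, and with this reading of validity every step of the search preserves
  validity and, except at progressing premises, decreases the total size of the other
  formulas.\<close>

section \<open>Finite trees as Kripke models\<close>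

datatype (dead 'v) tree = World (val: "'v set") (succs: "'v tree list")

text \<open>Pairing each child with its recursive value keeps the child itself available when
  primitive recursion goes through \<open>map\<close>.\<close>

primrec proper_subtrees :: "'v tree \<Rightarrow> 'v tree set" where
  "proper_subtrees (World V ts) = (\<Union>(t, A) \<in> set (map (\<lambda>t. (t, proper_subtrees t)) ts). insert t A)"

lemma proper_subtrees_World [simp]: "proper_subtrees (World V ts) = (\<Union>t \<in> set ts. insert t (proper_subtrees t))"
  by auto

declare proper_subtrees.simps [simp del]

lemma proper_subtrees_trans: "s \<in> proper_subtrees t \<Longrightarrow> proper_subtrees s \<subseteq> proper_subtrees t"
  by (induction t) auto

lemma size_proper_subtree: "s \<in> proper_subtrees t \<Longrightarrow> size s < size t"
proof (induction t)
  case (World V ts)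
  then obtain t where t: "t \<in> set ts" "s = t \<or> s \<in> proper_subtrees t"
    by auto
  have "size t < size (World V ts)"
    using t(1) by (simp add: less_Suc_eq_le size_list_estimation')
  moreover have "size s \<le> size t"
    using t World.IH by fastforce
  ultimately show ?case
    by linarith
qed

primrec holds :: "'v tree \<Rightarrow> 'v form \<Rightarrow> bool" where
  "holds t (Var p) \<longleftrightarrow> p \<in> val t"
| "holds t \<^bold>\<bottom> \<longleftrightarrow> False"
| "holds t (\<phi> \<^bold>\<rightarrow> \<psi>) \<longleftrightarrow> (holds t \<phi> \<longrightarrow> holds t \<psi>)"
| "holds t (\<^bold>\<box> \<phi>) \<longleftrightarrow> (\<forall>s \<in> insert t (proper_subtrees t). holds s \<phi>)"

section \<open>Refutation and soundness in the presence of cut\<close>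

definition refutes :: "'v tree \<Rightarrow> 'v sequent \<Rightarrow> bool" where
  "refutes t S \<longleftrightarrow>
    (\<forall>\<phi> \<in># fst S. holds t \<phi>) \<and> (\<forall>\<phi> \<in># snd S. \<not> holds t \<phi>)"

text \<open>Transitivity of the order. It carries the boxed antecedents of \<open>BoxR\<close> to
  the world that refutes the right premise.\<close>

lemma holds_Box_proper_subtree: "holds t (\<^bold>\<box> \<phi>) \<Longrightarrow> s \<in> proper_subtrees t \<Longrightarrow> holds s (\<^bold>\<box> \<phi>)"
  using proper_subtrees_trans by auto

lemma refutes_add_mset [simp]:
  "refutes t (add_mset \<phi> \<Gamma>, \<Delta>) \<longleftrightarrow> holds t \<phi> \<and> refutes t (\<Gamma>, \<Delta>)"
  "refutes t (\<Gamma>, add_mset \<phi> \<Delta>) \<longleftrightarrow> \<not> holds t \<phi> \<and> refutes t (\<Gamma>, \<Delta>)"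
  by (auto simp: refutes_def)

lemma refuted_premise:
  assumes "rule_inst r Ps C" "refutes w C"
  shows "\<exists>i w'. i < length Ps \<and> refutes w' (Ps ! i) \<and>
    size w' \<le> size w \<and> (r = BoxR \<and> i = 1 \<longrightarrow> size w' < size w)"
  using assms
proof cases
  case (ImpL \<Gamma> \<phi> \<Delta> \<psi>)
  show ?thesis
  proof (cases "holds w \<phi>")
    case True
    with ImpL assms(2) show ?thesis
      by (intro exI[of _ 1] exI[of _ w]) auto
  next
    case False
    with ImpL assms(2) show ?thesis
      by (intro exI[of _ 0] exI[of _ w]) auto
  qed
next
  case (ImpR \<phi> \<Gamma> \<psi> \<Delta>)
  with assms(2) show ?thesis
    by (intro exI[of _ 0] exI[of _ w]) auto
next
  case (Refl \<phi> \<Gamma> \<Delta>)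
  with assms(2) show ?thesis
    by (intro exI[of _ 0] exI[of _ w]) auto
next
  case (BoxR \<Gamma> \<Pi> \<phi> \<Delta>)
  show ?thesis
  \<comment> \<open>If \<phi> holds at \<open>w\<close>, then \<open>Box \<phi>\<close> can only
    fail because of a proper subtree, which is where the strict decrease comes from; otherwise
    \<open>w\<close> refutes the left premise.\<close>
  proof (cases "holds w \<phi>")
    case True
    with BoxR assms(2) obtain s where s: "s \<in> proper_subtrees w" "\<not> holds s \<phi>"
      by auto
    have "holds s (\<^bold>\<box> \<psi>)" if "\<psi> \<in># \<Pi>" for \<psi>
      using that BoxR(3) assms(2)
      by (intro holds_Box_proper_subtree[OF _ s(1)]) (auto simp: refutes_def simp del: holds.simps)
    then have "refutes s (image_mset Box \<Pi>, {#\<phi>#})"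
      using s(2) by (auto simp: refutes_def simp del: holds.simps)
    then show ?thesis
      using BoxR(2) size_proper_subtree[OF s(1)]
      by (intro exI[of _ 1] exI[of _ s]) simp
  next
    case False
    with BoxR assms(2) show ?thesis
      by (intro exI[of _ 0] exI[of _ w]) auto
  qed
next
  case (Cut \<Gamma> \<phi> \<Delta>)
  show ?thesis
  proof (cases "holds w \<phi>")
    case True
    with Cut assms(2) show ?thesis
      by (intro exI[of _ 1] exI[of _ w]) auto
  next
    case False
    with Cut assms(2) show ?thesis
      by (intro exI[of _ 0] exI[of _ w]) auto
  qed
qed (use assms(2) in auto)

text \<open>From an index where \<open>f\<close> attains its minimum, monotonicity keeps it
  constant.\<close>

lemma finite_strict_descents:
  fixes f :: "nat \<Rightarrow> nat"
  assumes "\<And>n. f (Suc n) \<le> f n"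
  shows "\<not> (\<exists>\<^sub>\<infinity>n. f (Suc n) < f n)"
proof
  assume inf: "\<exists>\<^sub>\<infinity>n. f (Suc n) < f n"
  obtain N where N: "\<And>n. f N \<le> f n"
    using exists_least_iff[of "\<lambda>m. m \<in> range f"] by (metis not_less rangeE rangeI)
  obtain n where n: "n \<ge> N" "f (Suc n) < f n"
    using inf by (auto simp: INFM_nat_le)
  have "f n \<le> f N"
    using lift_Suc_antimono_le[of f N n] assms n(1) by blast
  with n(2) N[of "Suc n"] show False
    by linarith
qed

text \<open>After a last \<open>P\<close>, the values would fall forever. This turns a measure that
  drops at all other steps into the progress condition.\<close>

lemma not_eventually_descending:
  fixes f :: "nat \<Rightarrow> nat"
  assumes "\<And>n. \<not> P n \<Longrightarrow> f (Suc n) < f n"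
  shows "\<exists>\<^sub>\<infinity>n. P n"
proof (rule ccontr)
  assume "\<not> ?thesis"
  then obtain N where N: "\<And>n. n \<ge> N \<Longrightarrow> \<not> P n"
    by (auto simp: INFM_nat_le)
  have "f (N + Suc n) < f (N + n)" for n
    using assms[of "N + n"] N by simp
  then have "\<exists>g. \<forall>n. (g (Suc n), g n) \<in> {(m :: nat, n). m < n}"
    by (intro exI[of _ "\<lambda>n. f (N + n)"]) simp
  then show False
    using wf_less unfolding wf_iff_no_infinite_down_chain by blast
qed

text \<open>\<open>refuted_premise\<close> always supplies a refuted child, so following it never
  stops and traces an infinite branch, on which progress would shrink the world infinitely
  often.\<close>

lemma soundness:
  assumes "has_proof R S"
  shows "\<not> refutes w S"
proof
  assume w: "refutes w S"
  obtain t where t: "concl t = S" "locally_correct R t" "progressing t"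
    using assms by (auto simp: has_proof_def is_proof_def)
  let ?P = "\<lambda>(u :: 'a ptree, v). locally_correct R u \<and> refutes v (concl u)"
  let ?Q = "\<lambda>(u, v) (u', v'). \<exists>i < length (children u). u' = children u ! i \<and>
    size v' \<le> size v \<and> (rule_of u = BoxR \<and> i = 1 \<longrightarrow> size v' < size v)"
  have step: "\<exists>y. ?P y \<and> ?Q x y" if "?P x" for x
  proof -
    obtain u v where x: "x = (u, v)" "locally_correct R u" "refutes v (concl u)"
      using \<open>?P x\<close> by (cases x) auto
    from x(2) have *: "rule_inst (rule_of u) (map concl (children u)) (concl u)"
      "\<forall>t \<in> set (children u). locally_correct R t"
      by (cases, simp)+
    obtain i v' where "i < length (children u)" "refutes v' (concl (children u ! i))"
      "size v' \<le> size v" "rule_of u = BoxR \<and> i = 1 \<longrightarrow> size v' < size v"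
      using refuted_premise[OF *(1) x(3)] by (metis length_map nth_map)
    then show ?thesis
      using x(1) *(2) by (intro exI[of _ "(children u ! i, v')"]) auto
  qed
  \<comment> \<open>The clause for \<open>n = 0\<close> pins the sequence to the root and the given
    world.\<close>
  have "\<exists>F. \<forall>n. (?P (F n) \<and> (n = 0 \<longrightarrow> F n = (t, w))) \<and> ?Q (F n) (F (Suc n))"
  proof (rule dependent_nat_choice)
    show "\<exists>x. ?P x \<and> (0 = (0 :: nat) \<longrightarrow> x = (t, w))"
      using t w by auto
    show "\<exists>y. (?P y \<and> (Suc n = 0 \<longrightarrow> y = (t, w))) \<and> ?Q x y"
      if "?P x \<and> (n = 0 \<longrightarrow> x = (t, w))" for x n
      using step[of x] that by blast
  qed
  then obtain F where F: "\<forall>n. (?P (F n) \<and> (n = 0 \<longrightarrow> F n = (t, w))) \<and> ?Q (F n) (F (Suc n))"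
    ..
  then have F0: "F 0 = (t, w)" and FSuc: "\<forall>n. ?Q (F n) (F (Suc n))"
    by simp_all
  define \<tau> where "\<tau> n = fst (F n)" for n
  define v where "v n = snd (F n)" for n
  \<comment> \<open>The same index must give the direction taken and decide whether the step
    progresses, so both are chosen together.\<close>
  have "\<exists>d. \<forall>n. d n < length (children (\<tau> n)) \<and> \<tau> (Suc n) = children (\<tau> n) ! d n \<and>
    size (v (Suc n)) \<le> size (v n) \<and>
    (rule_of (\<tau> n) = BoxR \<and> d n = 1 \<longrightarrow> size (v (Suc n)) < size (v n))"
    using FSuc unfolding \<tau>_def v_def by (intro choice) (auto simp: case_prod_beta)
  then obtain d where d: "\<And>n. d n < length (children (\<tau> n))"
    "\<And>n. \<tau> (Suc n) = children (\<tau> n) ! d n" "\<And>n. size (v (Suc n)) \<le> size (v n)"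
    "\<And>n. rule_of (\<tau> n) = BoxR \<and> d n = 1 \<Longrightarrow> size (v (Suc n)) < size (v n)"
    by blast
  have "infinite_branch t \<tau> d"
    using d(1,2) F0 by (auto simp: infinite_branch_def \<tau>_def)
  then have "\<exists>\<^sub>\<infinity>n. rule_of (\<tau> n) = BoxR \<and> d n = 1"
    using t(3) by (auto simp: progressing_def)
  then have "\<exists>\<^sub>\<infinity>n. size (v (Suc n)) < size (v n)"
    by (rule INFM_mono) (rule d(4))
  with finite_strict_descents[of "\<lambda>n. size (v n)"] d(3) show False
    by blast
qed

section \<open>Proofs by coinductive unfolding\<close>

primcorec unfold_tree ::
  "('s \<Rightarrow> 'v sequent) \<Rightarrow> ('s \<Rightarrow> rule) \<Rightarrow> ('s \<Rightarrow> 's list) \<Rightarrow> 's \<Rightarrow> 'v ptree" where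
  "unfold_tree c r next x =
    Node (c x) (r x) (map (unfold_tree c r next) (next x))"

text \<open>Fixing one choice of rule and successors per state gives a locally correct tree. \<mu>
  may grow only at right premises of \<open>BoxR\<close>, so every infinite branch passes these
  infinitely often.\<close>

lemma has_proof_unfold:
  fixes I :: "'s \<Rightarrow> bool" and c :: "'s \<Rightarrow> 'v sequent" and \<mu> :: "'s \<Rightarrow> nat"
  assumes step: "\<And>x. I x \<Longrightarrow> \<exists>r xs. r \<in> R \<and> rule_inst r (map c xs) (c x) \<and>
      (\<forall>i < length xs. I (xs ! i) \<and> (\<not> (r = BoxR \<and> i = 1) \<longrightarrow> \<mu> (xs ! i) < \<mu> x))"
    and "I x"
  shows "has_proof R (c x)"
proof -
  obtain r "next" where step: "\<And>x. I x \<Longrightarrow> r x \<in> R \<and> rule_inst (r x) (map c (next x)) (c x) \<and>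
      (\<forall>i < length (next x). I (next x ! i) \<and>
        (\<not> (r x = BoxR \<and> i = 1) \<longrightarrow> \<mu> (next x ! i) < \<mu> x))"
    using step by metis
  let ?u = "unfold_tree c r next"
  have concl: "concl \<circ> ?u = c"
    by (rule ext) simp
  have "locally_correct R (?u x)"
    using \<open>I x\<close>
  proof (coinduction arbitrary: x)
    case (locally_correct y)
    have "\<forall>z \<in> set (next y). I z"
      using step[OF locally_correct] by (auto simp: in_set_conv_nth)
    then show ?case
      using step[OF locally_correct] concl
      by (subst unfold_tree.code) (auto simp: comp_def)
  qed
  moreover have "progressing (?u x)"
    unfolding progressing_def
  proof (intro allI impI)
    fix \<tau> d
    assume b: "infinite_branch (?u x) \<tau> d"
    \<comment> \<open>The states met along the directions \<open>d\<close>; every tree on the branch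
      is the unfolding of its state, so \<mu> can be followed.\<close>
    define y where "y = rec_nat x (\<lambda>n y. next y ! d n)"
    have y: "y 0 = x" "\<And>n. y (Suc n) = next (y n) ! d n"
      by (simp_all add: y_def)
    have *: "I (y n) \<and> \<tau> n = ?u (y n) \<and> d n < length (next (y n))" for n
    proof (induction n)
      case 0
      then show ?case
        using b \<open>I x\<close> unfolding infinite_branch_def y(1)
        by (metis length_map unfold_tree.simps(3))
    next
      case (Suc n)
      then have "I (y (Suc n))" "\<tau> (Suc n) = ?u (y (Suc n))"
        using step[of "y n"] b by (auto simp: infinite_branch_def y(2))
      moreover have "d (Suc n) < length (children (\<tau> (Suc n)))"
        using b unfolding infinite_branch_def by blast
      ultimately show ?case
        by simp
    qed
    show "\<exists>\<^sub>\<infinity>n. rule_of (\<tau> n) = BoxR \<and> d n = 1"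
      by (rule not_eventually_descending[of _ "\<lambda>n. \<mu> (y n)"]) (use * step y in auto)
  qed
  ultimately show ?thesis
    unfolding has_proof_def is_proof_def by (intro exI[of _ "?u x"]) simp
qed

section \<open>Proof search and completeness\<close>

type_synonym 'v state = "'v form multiset \<times> 'v form multiset \<times> 'v form multiset"

fun sequent_of :: "'v state \<Rightarrow> 'v sequent" where
  "sequent_of (\<Gamma>, \<Theta>, \<Delta>) = (\<Gamma> + image_mset Box \<Theta>, \<Delta>)"

text \<open>Leaving out \<Theta> makes a \<open>Refl\<close> step decrease the size although the
  sequent grows: \<open>Box \<phi>\<close> becomes \<phi> in the counted part.\<close>

fun state_size :: "'v state \<Rightarrow> nat" where
  "state_size (\<Gamma>, \<Theta>, \<Delta>) = (\<Sum>\<phi> \<in># \<Gamma> + \<Delta>. size \<phi>)"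

text \<open>Leaving the root out of the condition on \<Theta> makes the \<open>Refl\<close> step an
  equivalence, and a newly glued root need not satisfy \<Theta>.\<close>

fun valid :: "'v state \<Rightarrow> bool" where
  "valid (\<Gamma>, \<Theta>, \<Delta>) \<longleftrightarrow>
    (\<forall>t. refutes t (\<Gamma>, \<Delta>) \<longrightarrow> (\<exists>\<theta> \<in># \<Theta>. \<exists>s \<in> proper_subtrees t. \<not> holds s \<theta>))"

text \<open>The states where no search step other than \<open>BoxR\<close> applies.\<close>

definition irreducible :: "'v form multiset \<Rightarrow> 'v form multiset \<Rightarrow> bool" where
  "irreducible \<Gamma> \<Delta> \<longleftrightarrow> (\<forall>\<phi> \<in># \<Gamma>. \<exists>p. \<phi> = Var p) \<and>
    (\<forall>\<phi> \<in># \<Delta>. (\<exists>p. \<phi> = Var p \<and> Var p \<notin># \<Gamma>) \<or> \<phi> = \<^bold>\<bottom> \<or> (\<exists>\<psi>. \<phi> = \<^bold>\<box> \<psi>))"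

text \<open>Countermodels of all sequents \<open>\<box>\<Theta> \<Rightarrow> \<phi>\<close> with \<open>\<box>\<phi>\<close> in \<open>\<Delta>\<close> can be glued together under
  a new root.\<close>

lemma irreducible_valid:
  assumes "valid (\<Gamma>, \<Theta>, \<Delta>)" "irreducible \<Gamma> \<Delta>"
  obtains \<phi> where "\<^bold>\<box> \<phi> \<in># \<Delta>" "valid (image_mset Box \<Theta>, {#}, {#\<phi>#})"
proof (rule ccontr)
  assume "\<not> thesis"
  with that have "\<And>\<phi>. \<^bold>\<box> \<phi> \<in># \<Delta> \<Longrightarrow> \<exists>t. refutes t (image_mset Box \<Theta>, {#\<phi>#})"
    by fastforce
  then obtain m where m: "\<And>\<phi>. \<^bold>\<box> \<phi> \<in># \<Delta> \<Longrightarrow> refutes (m \<phi>) (image_mset Box \<Theta>, {#\<phi>#})"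
    by metis
  \<comment> \<open>Children form a list, so only finitely many countermodels can be glued.\<close>
  have "finite {\<phi>. \<^bold>\<box> \<phi> \<in># \<Delta>}"
    using finite_vimageI[of "set_mset \<Delta>" Box] by (simp add: vimage_def inj_def)
  then obtain ts where ts: "set ts = m ` {\<phi>. \<^bold>\<box> \<phi> \<in># \<Delta>}"
    using finite_list[OF finite_imageI] by metis
  \<comment> \<open>If \<Delta> contains no boxed formula, \<open>ts\<close> is empty and this is a
    one-world countermodel, so the existence of a box is proved as well.\<close>
  define t where "t = World {p. Var p \<in># \<Gamma>} ts"
  have "holds t \<phi>" if "\<phi> \<in># \<Gamma>" for \<phi>
    using assms(2) that by (auto simp: irreducible_def t_def)
  moreover have "\<not> holds t \<phi>" if "\<phi> \<in># \<Delta>" for \<phi>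
    using assms(2) that m ts by (cases \<phi>) (force simp: irreducible_def refutes_def t_def)+
  moreover have "holds s \<theta>" if st: "\<theta> \<in># \<Theta>" "s \<in> proper_subtrees t" for s \<theta>
  proof -
    obtain \<phi> where \<phi>: "\<^bold>\<box> \<phi> \<in># \<Delta>" "s \<in> insert (m \<phi>) (proper_subtrees (m \<phi>))"
      using st(2) ts by (auto simp: t_def)
    have "holds (m \<phi>) (\<^bold>\<box> \<theta>)"
      using m[OF \<phi>(1)] st(1) by (simp add: refutes_def)
    with \<phi>(2) show ?thesis
      by auto
  qed
  ultimately show False
    using assms(1) unfolding valid.simps refutes_def fst_conv snd_conv by blast
qed

text \<open>The right premise of \<open>BoxR\<close> is valid by \<open>irreducible_valid\<close>;
  all other premises are valid because the rules are invertible for them.\<close>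

lemma search_step:
  assumes "valid x"
  shows "\<exists>r xs. r \<in> Grz \<and> rule_inst r (map sequent_of xs) (sequent_of x) \<and>
    (\<forall>i < length xs. valid (xs ! i) \<and>
      (\<not> (r = BoxR \<and> i = 1) \<longrightarrow> state_size (xs ! i) < state_size x))"
proof -
  obtain \<Gamma> \<Theta> \<Delta> where x: "x = (\<Gamma>, \<Theta>, \<Delta>)"
    by (cases x)
  consider (Ax) p \<Gamma>' \<Delta>' where "\<Gamma> = add_mset (Var p) \<Gamma>'" "\<Delta> = add_mset (Var p) \<Delta>'"
    | (BotL) \<Gamma>' where "\<Gamma> = add_mset \<^bold>\<bottom> \<Gamma>'"
    | (ImpL) \<phi> \<psi> \<Gamma>' where "\<Gamma> = add_mset (\<phi> \<^bold>\<rightarrow> \<psi>) \<Gamma>'"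
    | (ImpR) \<phi> \<psi> \<Delta>' where "\<Delta> = add_mset (\<phi> \<^bold>\<rightarrow> \<psi>) \<Delta>'"
    | (Refl) \<phi> \<Gamma>' where "\<Gamma> = add_mset (\<^bold>\<box> \<phi>) \<Gamma>'"
    | (irreducible) "irreducible \<Gamma> \<Delta>"
    unfolding irreducible_def by (metis form.exhaust mset_add)
  then show ?thesis
  proof cases
    case Ax
    then show ?thesis
      using rule_inst.Ax[of p "\<Gamma>' + image_mset Box \<Theta>" \<Delta>'] x
      by (intro exI[of _ rule.Ax] exI[of _ "[]"]) (auto simp: Grz_def)
  next
    case BotL
    then show ?thesis
      using rule_inst.BotL[of "\<Gamma>' + image_mset Box \<Theta>" \<Delta>] x
      by (intro exI[of _ rule.BotL] exI[of _ "[]"]) (auto simp: Grz_def)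
  next
    case ImpL
    then show ?thesis
      using rule_inst.ImpL[of "\<Gamma>' + image_mset Box \<Theta>" \<phi> \<Delta> \<psi>] x assms
      by (intro exI[of _ rule.ImpL]
            exI[of _ "[(\<Gamma>', \<Theta>, add_mset \<phi> \<Delta>), (add_mset \<psi> \<Gamma>', \<Theta>, \<Delta>)]"])
        (auto simp: Grz_def less_Suc_eq)
  next
    case ImpR
    then show ?thesis
      using rule_inst.ImpR[of \<phi> "\<Gamma> + image_mset Box \<Theta>" \<psi> \<Delta>'] x assms
      by (intro exI[of _ rule.ImpR] exI[of _ "[(add_mset \<phi> \<Gamma>, \<Theta>, add_mset \<psi> \<Delta>')]"])
        (auto simp: Grz_def)
  next
    case Refl
    then show ?thesis
      using rule_inst.Refl[of \<phi> "\<Gamma>' + image_mset Box \<Theta>" \<Delta>] x assms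
      by (intro exI[of _ rule.Refl] exI[of _ "[(add_mset \<phi> \<Gamma>', add_mset \<phi> \<Theta>, \<Delta>)]"])
        (auto simp: Grz_def add_mset_commute[of \<phi>])
  next
    case irreducible
    obtain \<phi> where "\<^bold>\<box> \<phi> \<in># \<Delta>" and \<phi>: "valid (image_mset Box \<Theta>, {#}, {#\<phi>#})"
      using irreducible_valid assms irreducible unfolding x by blast
    then obtain \<Delta>' where "\<Delta> = add_mset (\<^bold>\<box> \<phi>) \<Delta>'"
      by (meson mset_add)
    then show ?thesis
      \<comment> \<open>All of \<Theta> serves as \<Pi>. In the right premise its boxes return to
        the counted part, so the size may grow there.\<close>
      using rule_inst.BoxR[of \<Gamma> \<Theta> \<phi> \<Delta>'] x assms \<phi>
      by (intro exI[of _ rule.BoxR]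
            exI[of _ "[(\<Gamma>, \<Theta>, add_mset \<phi> \<Delta>'), (image_mset Box \<Theta>, {#}, {#\<phi>#})]"])
        (auto simp: Grz_def less_Suc_eq)
  qed
qed

text \<open>The search starts with empty \<Theta>, where \<open>valid\<close> is ordinary
  validity.\<close>

lemma completeness:
  assumes "\<And>t. \<not> refutes t S"
  shows "has_proof Grz S"
proof -
  have "valid (fst S, {#}, snd S)"
    using assms by simp
  from has_proof_unfold[of valid Grz sequent_of state_size, OF search_step this] show ?thesis
    by simp
qed

theorem theorem4p6:
  fixes S :: "'v sequent"
  assumes "has_proof Grz_cut S"
  shows "has_proof Grz S"
  using completeness soundness[OF assms] by blast

end
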